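(* Let $m$ be a positive integer and $q$ a real number with $1<q\leq m+1$, and let $$Y_m(q):=\left\{\sum_{i=0}^n\epsilon_i q^i:\ \epsilon_i\in \{0, \pm 1,\ldots, \pm m\},\ n=0, 1,\ldots \right\}.$$ Then $Y_m(q)$ has no accumulation points in $\mathbb{R}$ if and only if $0$ is not an accumulation point of $Y_m(q)$.
   Context: An accumulation point in $\mathbb{R}$ (a "finite accumulation point") of a set $S\subset\mathbb{R}$ is a real number $x$ such that every neighbourhood of $x$ contains a point of $S$ different from $x$. *)

theory Defs
  imports "HOL-Analysis.Analysis"
begin

definition Y :: "nat \<Rightarrow> real \<Rightarrow> real set" where
  "Y m q = {\<Sum>i=0..n. of_int (\<epsilon> i) * q ^ i | (\<epsilon> :: nat \<Rightarrow> int) (n :: nat).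
              \<forall>i\<in>{0..n}. \<epsilon> i \<in> {- int m..int m}}"

end

theory Submission
  imports Defs
begin

text \<open>
  \<open>Y m q\<close> is the set of differences of digit sums with digits \<open>0,\<dots>,m\<close>. If \<open>0\<close> is not an
  accumulation point of it, then the sets \<open>X\<^sub>n = digit_sums m q n\<close> of digit sums of length
  \<open>n\<close> are uniformly separated, so some unit window \<open>[x, x + 1]\<close>, \<open>x \<in> X\<^sub>N\<close>, contains the
  largest possible number of points of any \<open>X\<^sub>n\<close>. Prefixing the digits of an arbitrary \<open>z\<close>
  translates this window by \<open>z q\<^sup>N\<close>, and by maximality all points in the translated window
  are translates of points of the original one. For \<open>q < m + 1\<close> the window can moreover be
  chosen with \<open>x \<ge> q\<^sup>N\<close>; then any \<open>z' \<in> [z, z + 1]\<close> also has an extension in the translated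
  window, as \<open>X\<^sub>N\<close> has gaps at most \<open>1\<close>. This confines \<open>z' - z\<close> to a finite set depending
  only on \<open>N\<close>. Larger differences are sums of boundedly many differences in \<open>(0, 1]\<close>. For
  \<open>q = m + 1\<close> the set consists of integers.
\<close>

section \<open>Digit sums in base \<open>q\<close>: range, concatenation, gaps\<close>

primrec digit_sums :: "nat \<Rightarrow> real \<Rightarrow> nat \<Rightarrow> real set" where
  "digit_sums m q 0 = {0}"
| "digit_sums m q (Suc n) = (\<lambda>(x, d). x + real d * q ^ n) ` (digit_sums m q n \<times> {..m})"

definition max_sum :: "nat \<Rightarrow> real \<Rightarrow> nat \<Rightarrow> real" where
  "max_sum m q n = real m * (\<Sum>i<n. q ^ i)"

lemma max_sum_0 [simp]: "max_sum m q 0 = 0"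
  and max_sum_Suc: "max_sum m q (Suc n) = max_sum m q n + real m * q ^ n"
  by (simp_all add: max_sum_def algebra_simps)

lemma max_sum_closed_form: "max_sum m q n * (q - 1) = real m * (q ^ n - 1)"
  by (induction n) (simp_all add: max_sum_Suc algebra_simps)

text \<open>The source of the gap bound: the next power exceeds the largest shorter sum by at most
  1. The induction rests on \<open>q ^ Suc n \<le> q ^ n + m * q ^ n\<close>.\<close>

lemma max_sum_ge:
  assumes "1 < q" "q \<le> real m + 1"
  shows "q ^ n - 1 \<le> max_sum m q n"
proof (induction n)
  case (Suc n)
  have "q ^ n * q \<le> q ^ n * (real m + 1)"
    using assms by (intro mult_left_mono) auto
  with Suc show ?case by (simp add: max_sum_Suc algebra_simps)
qed simp

lemma finite_digit_sums: "finite (digit_sums m q n)"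
  by (induction n) auto

lemma digit_sumsE:
  assumes "x \<in> digit_sums m q (Suc n)"
  obtains y d where "y \<in> digit_sums m q n" "d \<le> m" "x = y + real d * q ^ n"
  using assms by auto

lemma digit_sums_SucI:
  "x \<in> digit_sums m q n \<Longrightarrow> d \<le> m \<Longrightarrow> x + real d * q ^ n \<in> digit_sums m q (Suc n)"
  by force

declare digit_sums.simps(2) [simp del]

lemma zero_in_digit_sums: "0 \<in> digit_sums m q n"
proof (induction n)
  case (Suc n)
  from digit_sums_SucI[OF this, of 0] show ?case by simp
qed simp

lemma max_sum_in_digit_sums: "max_sum m q n \<in> digit_sums m q n"
proof (induction n)
  case (Suc n)
  from digit_sums_SucI[OF this, of m] show ?case by (simp add: max_sum_Suc)
qed simp

lemma digit_sums_bounds: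
  assumes "0 \<le> q" "x \<in> digit_sums m q n"
  shows "0 \<le> x" "x \<le> max_sum m q n"
proof -
  have "0 \<le> x \<and> x \<le> max_sum m q n"
    using assms(2)
  proof (induction n arbitrary: x)
    case (Suc n)
    obtain y d where y: "y \<in> digit_sums m q n" "d \<le> m" "x = y + real d * q ^ n"
      using Suc.prems by (rule digit_sumsE)
    have "real d * q ^ n \<le> real m * q ^ n"
      using y assms(1) by (intro mult_right_mono) auto
    moreover have "0 \<le> real d * q ^ n" using assms(1) by simp
    ultimately show ?case using Suc.IH[OF y(1)] unfolding y(3) max_sum_Suc by linarith
  qed simp
  then show "0 \<le> x" "x \<le> max_sum m q n" by auto
qed

text \<open>Multiplication by \<open>q ^ n\<close> moves the digits of \<open>w\<close> above the
  \<open>n\<close> digits of \<open>x\<close>, so the two strings concatenate.\<close>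

lemma digit_sums_append:
  assumes "w \<in> digit_sums m q k" "x \<in> digit_sums m q n"
  shows "w * q ^ n + x \<in> digit_sums m q (k + n)"
  using assms(1)
proof (induction k arbitrary: w)
  case 0
  with assms(2) show ?case by simp
next
  case (Suc k)
  obtain v d where v: "v \<in> digit_sums m q k" "d \<le> m" "w = v + real d * q ^ k"
    using Suc.prems by (rule digit_sumsE)
  have "w * q ^ n + x = (v * q ^ n + x) + real d * q ^ (k + n)"
    by (simp add: v(3) distrib_right power_add)
  with digit_sums_SucI[OF Suc.IH[OF v(1)] v(2)] show ?case by (simp only: add_Suc)
qed

text \<open>Greedy expansion from the top: either the remainder is within reach of the lower digits,
  or raising the top digit by one overshoots \<open>s\<close> by at most 1.\<close>

lemma digit_sums_gap:
  assumes q: "1 < q" "q \<le> real m + 1" and s: "0 \<le> s" "s < max_sum m q n"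
  shows "\<exists>x\<in>digit_sums m q n. s < x \<and> x \<le> s + 1"
  using s
proof (induction n arbitrary: s)
  case (Suc n)
  \<comment> \<open>The largest top digit with \<open>d * q ^ n \<le> s\<close>, capped at
    \<open>m\<close>.\<close>
  define d where "d = min m (nat \<lfloor>s / q ^ n\<rfloor>)"
  define r where "r = s - real d * q ^ n"
  have qn: "0 < q ^ n" using q by simp
  have "real (nat \<lfloor>s / q ^ n\<rfloor>) \<le> s / q ^ n"
    using Suc.prems(1) qn by (intro of_nat_floor) simp
  then have "real d \<le> s / q ^ n" by (rule order_trans[rotated]) (simp add: d_def)
  then have r0: "0 \<le> r"
    using qn by (simp add: r_def field_simps)
  show ?case
  proof (cases "r < max_sum m q n")
    case True
    with Suc.IH[OF r0] obtain x where x: "x \<in> digit_sums m q n" "r < x" "x \<le> r + 1"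
      by blast
    have "x + real d * q ^ n \<in> digit_sums m q (Suc n)"
      by (rule digit_sums_SucI[OF x(1)]) (simp add: d_def)
    with x(2,3) show ?thesis unfolding r_def by (intro bexI) auto
  next
    case False
    \<comment> \<open>With \<open>d = m\<close>, \<open>s\<close> would reach
      \<open>max_sum m q (Suc n)\<close>. So the cap is inactive, and \<open>Suc d\<close> followed
      by zeros is the witness.\<close>
    with Suc.prems(2) have "d \<noteq> m" by (auto simp: r_def max_sum_Suc)
    then have "nat \<lfloor>s / q ^ n\<rfloor> < m" unfolding d_def min.absorb_iff1[symmetric] by simp
    then have "d < m" and "d = nat \<lfloor>s / q ^ n\<rfloor>" by (simp_all add: d_def)
    then have "s / q ^ n < real d + 1" using Suc.prems(1) qn by linarith
    then have "s < real (Suc d) * q ^ n" using qn by (simp add: field_simps)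
    moreover have "real (Suc d) * q ^ n \<le> s + 1"
      using False max_sum_ge[OF q, of n] by (simp add: r_def algebra_simps)
    moreover have "real (Suc d) * q ^ n \<in> digit_sums m q (Suc n)"
      using digit_sums_SucI[OF zero_in_digit_sums, of "Suc d" m q n] \<open>d < m\<close> by simp
    ultimately show ?thesis by blast
  qed
qed simp

section \<open>\<open>Y m q\<close> as a set of differences\<close>

text \<open>Each signed digit splits into its positive and negative part; conversely, digits are
  subtracted place by place.\<close>

lemma Y_iff: "y \<in> Y m q \<longleftrightarrow> (\<exists>n. \<exists>a\<in>digit_sums m q n. \<exists>b\<in>digit_sums m q n. y = a - b)"
proof
  assume "y \<in> Y m q"
  then obtain \<epsilon> :: "nat \<Rightarrow> int" and N
    where range: "\<forall>i\<in>{0..N}. \<epsilon> i \<in> {- int m..int m}"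
      and y: "y = (\<Sum>i=0..N. of_int (\<epsilon> i) * q ^ i)"
    unfolding Y_def by blast
  from range have \<epsilon>: "\<bar>\<epsilon> i\<bar> \<le> int m" if "i \<le> N" for i
    using that by (simp add: abs_le_iff minus_le_iff)
  have "\<exists>a\<in>digit_sums m q n. \<exists>b\<in>digit_sums m q n. (\<Sum>i<n. of_int (\<epsilon> i) * q ^ i) = a - b"
    if "n \<le> Suc N" for n
    using that
  proof (induction n)
    case (Suc n)
    then obtain a b where ab: "a \<in> digit_sums m q n" "b \<in> digit_sums m q n"
      "(\<Sum>i<n. of_int (\<epsilon> i) * q ^ i) = a - b" by auto
    have "nat (\<epsilon> n) \<le> m" "nat (- \<epsilon> n) \<le> m" using \<epsilon>[of n] Suc.prems by simp_all
    note digit_sums_SucI[OF ab(1) this(1)] digit_sums_SucI[OF ab(2) this(2)]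
    moreover have "of_int (\<epsilon> n) = real (nat (\<epsilon> n)) - real (nat (- \<epsilon> n))" by simp
    then have "(\<Sum>i<Suc n. of_int (\<epsilon> i) * q ^ i)
        = (a + real (nat (\<epsilon> n)) * q ^ n) - (b + real (nat (- \<epsilon> n)) * q ^ n)"
      using ab(3) by (simp only: sum.lessThan_Suc) (simp only: algebra_simps)
    ultimately show ?case by blast
  qed simp
  from this[of "Suc N"] y
  show "\<exists>n. \<exists>a\<in>digit_sums m q n. \<exists>b\<in>digit_sums m q n. y = a - b"
    by (auto simp only: lessThan_Suc_atMost atLeast0AtMost)
next
  assume "\<exists>n. \<exists>a\<in>digit_sums m q n. \<exists>b\<in>digit_sums m q n. y = a - b"
  then obtain n a b where ab: "a \<in> digit_sums m q n" "b \<in> digit_sums m q n" "y = a - b"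
    by blast
  have "\<exists>\<epsilon>::nat \<Rightarrow> int. (\<forall>i. \<epsilon> i \<in> {- int m..int m})
      \<and> a - b = (\<Sum>i<n. of_int (\<epsilon> i) * q ^ i)"
    using ab(1,2)
  proof (induction n arbitrary: a b)
    case 0
    then show ?case by (auto intro!: exI[of _ "\<lambda>_. 0"])
  next
    case (Suc n)
    obtain a' d where a: "a' \<in> digit_sums m q n" "d \<le> m" "a = a' + real d * q ^ n"
      using Suc.prems(1) by (rule digit_sumsE)
    obtain b' e where b: "b' \<in> digit_sums m q n" "e \<le> m" "b = b' + real e * q ^ n"
      using Suc.prems(2) by (rule digit_sumsE)
    obtain \<epsilon> :: "nat \<Rightarrow> int" where \<epsilon>: "\<forall>i. \<epsilon> i \<in> {- int m..int m}"
      "a' - b' = (\<Sum>i<n. of_int (\<epsilon> i) * q ^ i)"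
      using Suc.IH[OF a(1) b(1)] by blast
    have "a - b = (\<Sum>i<Suc n. of_int ((\<epsilon>(n := int d - int e)) i) * q ^ i)"
      using \<epsilon>(2) a(3) b(3) by (simp add: left_diff_distrib)
    then show ?case
      using \<epsilon>(1) a(2) b(2) by (intro exI[of _ "\<epsilon>(n := int d - int e)"]) simp
  qed
  then obtain \<epsilon> :: "nat \<Rightarrow> int" where \<epsilon>: "\<forall>i. \<epsilon> i \<in> {- int m..int m}"
    "y = (\<Sum>i<n. of_int (\<epsilon> i) * q ^ i)" using ab(3) by blast
  \<comment> \<open>\<open>Y\<close> sums over \<open>i \<le> n\<close>, a digit sum of length
    \<open>n\<close> over \<open>i < n\<close>; the extra top digit is padded with 0.\<close>
  have "y = (\<Sum>i=0..n. of_int ((\<epsilon>(n := 0)) i) * q ^ i)"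
    unfolding \<epsilon>(2) atLeast0AtMost lessThan_Suc_atMost[symmetric] sum.lessThan_Suc by simp
  moreover have "\<forall>i\<in>{0..n}. (\<epsilon>(n := 0)) i \<in> {- int m..int m}" using \<epsilon>(1) by auto
  ultimately show "y \<in> Y m q" unfolding Y_def by blast
qed

lemma diff_in_Y: "a \<in> digit_sums m q n \<Longrightarrow> b \<in> digit_sums m q n \<Longrightarrow> a - b \<in> Y m q"
  by (auto simp: Y_iff)

lemma uminus_in_Y:
  assumes "y \<in> Y m q"
  shows "- y \<in> Y m q"
proof -
  from assms obtain n a b where "a \<in> digit_sums m q n" "b \<in> digit_sums m q n" "y = a - b"
    unfolding Y_iff by blast
  then show ?thesis using diff_in_Y[of b m q n a] by simp
qed

section \<open>Separation and windows of maximal cardinality\<close>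

text \<open>Pigeonhole: the floor numbers half-open cells of length \<open>\<delta>\<close>, each
  holding at most one point of \<open>S\<close>.\<close>

lemma card_separated_le:
  fixes S :: "real set"
  assumes "0 < \<delta>" and sep: "\<And>s t. s \<in> S \<Longrightarrow> t \<in> S \<Longrightarrow> s \<noteq> t \<Longrightarrow> \<delta> \<le> \<bar>s - t\<bar>"
    and "S \<subseteq> {a..b}"
  shows "card S \<le> card {0..\<lfloor>(b - a) / \<delta>\<rfloor>}"
proof (rule card_inj_on_le[where f = "\<lambda>s. \<lfloor>(s - a) / \<delta>\<rfloor>"])
  show "inj_on (\<lambda>s. \<lfloor>(s - a) / \<delta>\<rfloor>) S"
  proof (rule inj_onI, rule ccontr)
    fix s t assume st: "s \<in> S" "t \<in> S" "\<lfloor>(s - a) / \<delta>\<rfloor> = \<lfloor>(t - a) / \<delta>\<rfloor>" "s \<noteq> t"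
    then have "\<bar>(s - a) / \<delta> - (t - a) / \<delta>\<bar> < 1" by linarith
    then have "\<bar>s - t\<bar> < \<delta>"
      using \<open>0 < \<delta>\<close> by (simp add: diff_divide_distrib[symmetric])
    with sep[OF st(1,2,4)] show False by simp
  qed
  show "(\<lambda>s. \<lfloor>(s - a) / \<delta>\<rfloor>) ` S \<subseteq> {0..\<lfloor>(b - a) / \<delta>\<rfloor>}"
  proof (rule image_subsetI)
    fix s assume "s \<in> S"
    with assms(3) have "a \<le> s" "s \<le> b" by auto
    with \<open>0 < \<delta>\<close> show "\<lfloor>(s - a) / \<delta>\<rfloor> \<in> {0..\<lfloor>(b - a) / \<delta>\<rfloor>}"
      by (simp add: floor_mono divide_right_mono)
  qed
qed simp

lemma Y_separated:
  assumes "\<not> 0 islimpt Y m q"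
  obtains \<delta> where "0 < \<delta>" "\<And>y. y \<in> Y m q \<Longrightarrow> y \<noteq> 0 \<Longrightarrow> \<delta> \<le> \<bar>y\<bar>"
  using assms by (auto simp: islimpt_approachable not_less)

definition window :: "nat \<Rightarrow> real \<Rightarrow> nat \<Rightarrow> real \<Rightarrow> real set" where
  "window m q n x = digit_sums m q n \<inter> {x..x + 1}"

lemma finite_window: "finite (window m q n x)"
  by (simp add: window_def finite_digit_sums)

lemma translate_window_subset:
  assumes "w \<in> digit_sums m q k"
  shows "(+) (w * q ^ n) ` window m q n x \<subseteq> window m q (k + n) (w * q ^ n + x)"
  using digit_sums_append[OF assms] by (auto simp: window_def)

lemma card_translate_window_le:
  assumes "w \<in> digit_sums m q k"
  shows "card (window m q n x) \<le> card (window m q (k + n) (w * q ^ n + x))"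
  using card_mono[OF finite_window translate_window_subset[OF assms]]
  by (simp add: card_image)

text \<open>Differences within a window lie in \<open>Y m q\<close>, so separation bounds its
  cardinality independently of length and position, and a bounded set of naturals attains its
  maximum.\<close>

lemma maximal_window_exists:
  assumes "\<not> 0 islimpt Y m q"
  obtains n x where "x \<in> digit_sums m q n"
    "\<And>k y. y \<in> digit_sums m q k \<Longrightarrow> card (window m q k y) \<le> card (window m q n x)"
proof -
  obtain \<delta> where \<delta>: "0 < \<delta>" "\<And>y. y \<in> Y m q \<Longrightarrow> y \<noteq> 0 \<Longrightarrow> \<delta> \<le> \<bar>y\<bar>"
    using Y_separated[OF assms] by blast
  have "card (window m q k y) \<le> card {0..\<lfloor>(y + 1 - y) / \<delta>\<rfloor>}" for k y
    by (rule card_separated_le[OF \<delta>(1)]) (auto simp: window_def intro!: \<delta>(2) diff_in_Y)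
  then have bound: "card (window m q k y) \<le> card {0..\<lfloor>1 / \<delta>\<rfloor>}" for k y
    by simp
  let ?P = "\<lambda>c. \<exists>k. \<exists>y\<in>digit_sums m q k. c = card (window m q k y)"
  have "?P (card (window m q 0 0))" by force
  moreover have "\<forall>c. ?P c \<longrightarrow> c \<le> card {0..\<lfloor>1 / \<delta>\<rfloor>}"
    using bound by blast
  ultimately have "\<exists>c. ?P c \<and> (\<forall>c'. ?P c' \<longrightarrow> c' \<le> c)"
    by (rule Nat.ex_has_greatest_nat)
  then show thesis using that by blast
qed

text \<open>Prefixing \<open>k\<close> digits \<open>m\<close> to a maximal window loses no points,
  so the result is again maximal. As \<open>q < m + 1\<close>, \<open>max_sum m q k\<close> is at
  least \<open>q ^ k\<close> for large \<open>k\<close>, which pushes the left end past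
  \<open>q ^ (k + n)\<close>.\<close>

lemma maximal_far_window_exists:
  assumes q: "1 < q" "q < real m + 1" and "\<not> 0 islimpt Y m q"
  obtains n x where "x \<in> digit_sums m q n" "q ^ n \<le> x"
    "\<And>k y. y \<in> digit_sums m q k \<Longrightarrow> card (window m q k y) \<le> card (window m q n x)"
proof -
  obtain n x where x: "x \<in> digit_sums m q n"
    and max: "\<And>k y. y \<in> digit_sums m q k \<Longrightarrow> card (window m q k y) \<le> card (window m q n x)"
    by (rule maximal_window_exists[OF assms(3)]) blast
  \<comment> \<open>The threshold is \<open>q ^ k * (q - 1) < m * (q ^ k - 1)\<close> rearranged,
    whose right side is \<open>max_sum m q k * (q - 1)\<close>.\<close>
  obtain k where "real m / (real m + 1 - q) < q ^ k"
    using real_arch_pow[OF q(1)] by blast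
  then have "real m < q ^ k * (real m + 1 - q)"
    using q by (simp add: pos_divide_less_eq)
  then have "q ^ k * (q - 1) \<le> max_sum m q k * (q - 1)"
    unfolding max_sum_closed_form by (simp add: algebra_simps)
  then have "q ^ k \<le> max_sum m q k" using q by simp
  then have "q ^ k * q ^ n \<le> max_sum m q k * q ^ n"
    using q by (intro mult_right_mono) auto
  moreover have "0 \<le> x" using digit_sums_bounds(1)[OF _ x] q by simp
  ultimately have "q ^ (k + n) \<le> max_sum m q k * q ^ n + x"
    unfolding power_add by linarith
  moreover note digit_sums_append[OF max_sum_in_digit_sums x, of k]
  moreover have "card (window m q j y) \<le> card (window m q (k + n) (max_sum m q k * q ^ n + x))"
    if "y \<in> digit_sums m q j" for j y
    using max[OF that] card_translate_window_le[OF max_sum_in_digit_sums] by (rule order_trans)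
  ultimately show thesis using that by blast
qed

section \<open>Finiteness of bounded parts of \<open>Y m q\<close>\<close>

lemma finite_Y_unit:
  assumes q: "1 < q" "q < real m + 1" and "\<not> 0 islimpt Y m q"
  shows "finite (Y m q \<inter> {0<..1})"
proof -
  obtain n x where x: "x \<in> digit_sums m q n" "q ^ n \<le> x"
    and max: "\<And>k y. y \<in> digit_sums m q k \<Longrightarrow> card (window m q k y) \<le> card (window m q n x)"
    by (rule maximal_far_window_exists[OF assms]) blast
  let ?F = "(\<lambda>(v, u). (v - u) / q ^ n) ` (digit_sums m q n \<times> digit_sums m q n)"
  have "Y m q \<inter> {0<..1} \<subseteq> ?F"
  proof
    fix y assume y: "y \<in> Y m q \<inter> {0<..1}"
    then obtain k z' z where z: "z' \<in> digit_sums m q k" "z \<in> digit_sums m q k" "y = z' - z"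
      by (auto simp: Y_iff)
    have yq: "y * q ^ n = z' * q ^ n - z * q ^ n"
      unfolding z(3) by (rule left_diff_distrib)
    \<comment> \<open>The gap lemma needs a start in range: \<open>y \<le> 1\<close> and
      \<open>q ^ n \<le> x\<close> keep \<open>x - y * q ^ n\<close> nonnegative, and
      \<open>0 < y\<close> keeps it strictly below the maximum.\<close>
    have "y * q ^ n \<le> q ^ n" using y q by simp
    moreover have "0 < y * q ^ n" using y q by simp
    moreover have "x \<le> max_sum m q n" using digit_sums_bounds(2)[OF _ x(1)] q by simp
    ultimately have "0 \<le> x - y * q ^ n" "x - y * q ^ n < max_sum m q n"
      using x(2) by linarith+
    then obtain u where u: "u \<in> digit_sums m q n" "x - y * q ^ n < u" "u \<le> x - y * q ^ n + 1"
      using digit_sums_gap[OF q(1) less_imp_le[OF q(2)]] by blast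
    \<comment> \<open>By maximality the larger window has no more points than the translate it
      contains, so the two are equal.\<close>
    have "(+) (z * q ^ n) ` window m q n x = window m q (k + n) (z * q ^ n + x)"
      using max[OF digit_sums_append[OF z(2) x(1)]]
      by (intro card_seteq finite_window translate_window_subset z(2)) (simp add: card_image)
    moreover have "z' * q ^ n + u \<in> window m q (k + n) (z * q ^ n + x)"
      using u yq digit_sums_append[OF z(1) u(1)] by (simp add: window_def)
    ultimately have "z' * q ^ n + u \<in> (+) (z * q ^ n) ` window m q n x" by simp
    then obtain v where v: "v \<in> digit_sums m q n" "z' * q ^ n + u = z * q ^ n + v"
      by (auto simp: window_def)
    from v(2) yq have "y * q ^ n = v - u" by linarith
    then have "y = (v - u) / q ^ n"
      using q by (simp add: eq_divide_eq)
    then show "y \<in> ?F" using u(1) v(1) by (intro image_eqI[of _ _ "(v, u)"]) simp_all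
  qed
  then show ?thesis
    by (rule finite_subset) (simp add: finite_digit_sums)
qed

text \<open>Induction in steps of \<open>\<delta>\<close>: a difference above 1 is cut at a digit
  sum within 1 above its lower end.\<close>

lemma finite_Y_nonneg:
  assumes q: "1 < q" "q < real m + 1" and lim: "\<not> 0 islimpt Y m q"
  shows "finite (Y m q \<inter> {0..C})"
proof -
  obtain \<delta> where \<delta>: "0 < \<delta>" "\<And>y. y \<in> Y m q \<Longrightarrow> y \<noteq> 0 \<Longrightarrow> \<delta> \<le> \<bar>y\<bar>"
    using Y_separated[OF lim] by blast
  have q0: "0 \<le> q" using q by simp
  have step: "finite (Y m q \<inter> {0..real j * \<delta>})" for j
  proof (induction j)
    case 0
    then show ?case by (simp add: finite_subset[of _ "{0}"])
  next
    case (Suc j)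
    let ?A = "Y m q \<inter> {0<..1}" and ?B = "Y m q \<inter> {0..real j * \<delta>}"
    have "Y m q \<inter> {0..real (Suc j) * \<delta>} \<subseteq> insert 0 ((\<lambda>(a, b). a + b) ` (?A \<times> ?B) \<union> ?A)"
    proof
      fix y assume y: "y \<in> Y m q \<inter> {0..real (Suc j) * \<delta>}"
      then obtain k z' z where z: "z' \<in> digit_sums m q k" "z \<in> digit_sums m q k" "y = z' - z"
        by (auto simp: Y_iff)
      show "y \<in> insert 0 ((\<lambda>(a, b). a + b) ` (?A \<times> ?B) \<union> ?A)"
      proof (cases "1 < y")
        case True
        then have "0 \<le> z" "z < max_sum m q k"
          using digit_sums_bounds(2)[OF q0 z(1)] digit_sums_bounds(1)[OF q0 z(2)] z(3)
          by linarith+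
        then obtain u where u: "u \<in> digit_sums m q k" "z < u" "u \<le> z + 1"
          using digit_sums_gap[OF q(1) less_imp_le[OF q(2)]] by blast
        have "u - z \<in> ?A" using u z by (auto intro: diff_in_Y)
        \<comment> \<open>Removing at least \<open>\<delta>\<close> brings the rest below
          \<open>j * \<delta>\<close>; it stays nonnegative since \<open>u \<le> z + 1\<close> and
          \<open>y > 1\<close>.\<close>
        moreover have "\<delta> \<le> u - z" using \<delta>(2)[OF diff_in_Y[OF u(1) z(2)]] u(2) by simp
        then have "z' - u \<in> ?B"
          using diff_in_Y[OF z(1) u(1)] y u(3) z(3) True by (simp add: distrib_right)
        ultimately have "(u - z, z' - u) \<in> ?A \<times> ?B" by (rule SigmaI)
        then show ?thesis
          by (rule insertI2[OF UnI1[OF image_eqI[rotated]]]) (simp add: z(3))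
      next
        case False
        with y have "y = 0 \<or> y \<in> ?A" by simp linarith
        then show ?thesis by blast
      qed
    qed
    moreover have "finite (insert 0 ((\<lambda>(a, b). a + b) ` (?A \<times> ?B) \<union> ?A))"
      using Suc.IH finite_Y_unit[OF assms]
      by (intro finite.insertI finite_UnI finite_imageI finite_cartesian_product)
    ultimately show ?case by (rule finite_subset)
  qed
  obtain j where "C / \<delta> < real j" using reals_Archimedean2 by blast
  then have "C \<le> real j * \<delta>" using \<delta>(1) by (simp add: field_simps)
  then show ?thesis by (intro finite_subset[OF _ step[of j]]) auto
qed

text \<open>By symmetry the nonnegative half suffices. The case \<open>q = m + 1\<close> stands
  apart because there \<open>max_sum m q n = q ^ n - 1\<close>, so far windows do not exist.\<close>

lemma finite_Y_bounded:
  assumes q: "1 < q" "q \<le> real m + 1" and lim: "\<not> 0 islimpt Y m q"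
  shows "finite (Y m q \<inter> {-C..C})"
proof (cases "q = real m + 1")
  case True
  then have "q \<in> \<int>" by simp
  then have "Y m q \<subseteq> \<int>" by (auto simp: Y_def intro!: Ints_mult Ints_power)
  then show ?thesis by (intro finite_subset[OF _ finite_int_segment[of "-C" C]]) auto
next
  case False
  then have fin: "finite (Y m q \<inter> {0..C})" using finite_Y_nonneg[OF q(1) _ lim] q(2) by simp
  have "Y m q \<inter> {-C..C} \<subseteq> (Y m q \<inter> {0..C}) \<union> uminus ` (Y m q \<inter> {0..C})"
  proof
    fix y assume y: "y \<in> Y m q \<inter> {-C..C}"
    then have "0 \<le> y \<Longrightarrow> y \<in> Y m q \<inter> {0..C}" "y \<le> 0 \<Longrightarrow> - y \<in> Y m q \<inter> {0..C}"
      using uminus_in_Y by auto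
    then show "y \<in> (Y m q \<inter> {0..C}) \<union> uminus ` (Y m q \<inter> {0..C})"
      by (metis Un_iff image_eqI linear minus_minus)
  qed
  then show ?thesis by (rule finite_subset) (intro finite_UnI finite_imageI fin)
qed

theorem theorem1p4:
  fixes m :: nat and q :: real
  assumes "m > 0" and "1 < q" and "q \<le> real m + 1"
  shows "(\<nexists>x. x islimpt Y m q) \<longleftrightarrow> \<not> 0 islimpt Y m q"
proof
  assume lim: "\<not> 0 islimpt Y m q"
  show "\<nexists>x. x islimpt Y m q"
  proof
    assume "\<exists>x. x islimpt Y m q"
    then obtain x where "x islimpt Y m q" ..
    \<comment> \<open>A limit point puts infinitely many points into a unit ball, which lies in a
      bounded symmetric interval.\<close>
    then have "infinite (Y m q \<inter> ball x 1)" by (simp add: islimpt_eq_infinite_ball)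
    moreover have "Y m q \<inter> ball x 1 \<subseteq> Y m q \<inter> {-(\<bar>x\<bar> + 1)..\<bar>x\<bar> + 1}"
      unfolding ball_eq_greaterThanLessThan
      by (intro Int_mono subset_refl greaterThanLessThan_subseteq_atLeastAtMost_iff[THEN iffD2]) linarith
    ultimately show False
      using finite_Y_bounded[OF assms(2,3) lim] finite_subset by blast
  qed
qed blast

end
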